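(* Let $N\ge3$, $\alpha\in(0,1]$, $h>0$, and consider the stabilized cut DG scheme with piecewise constants in space ($r=0$), upwind flux and explicit Euler time discretization with time step $\Delta t>0$ for the linear advection equation $u_t+u_x=0$ ($\beta=1$) with periodic boundary condition, i.e. with $\lambda=\Delta t/h$, $$\alpha u_1^{n+1}+\gamma_M u_1^{n+1}-\gamma_M u_2^{n+1}=\alpha u_1^n-\gamma_M u_2^n+\gamma_M u_1^n+\lambda(u_N^n-u_1^n)+\lambda\gamma_A(u_2^n-u_1^n),$$ $$u_2^{n+1}+\gamma_M u_2^{n+1}-\gamma_M u_1^{n+1}=u_2^n-\gamma_M u_1^n+\gamma_M u_2^n+\lambda(u_1^n-u_2^n)-\lambda\gamma_A(u_2^n-u_1^n),$$ $$u_j^{n+1}=u_j^n+\lambda(u_{j-1}^n-u_j^n),\qquad j=3,\dots,N.$$ If the time step satisfies $$\frac{\Delta t}{h}\le \alpha+\frac{\gamma_M}{\gamma_M+1},$$ and the parameters satisfy $0<\gamma_M\le\gamma_A$ and $(1+\alpha)\gamma_A-\gamma_M\le 1-\alpha$, then the scheme is TVD stable, i.e. $TV(u_h^{n+1})\le TV(u_h^n)$ for every $n$, where $$TV(u_h^n)=\sum_{j=1}^N|u_j^n-u_{j-1}^n|,\qquad u_0^n:=u_N^n .$$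
   Context: **Mesh.** The background mesh has $N$ elements $I_j=[x_{j-1/2},x_{j+1/2}]$ of equal length $h$. The physical domain $\Omega=(x_l,x_r)$ has $x_r=x_{N+1/2}$ and $x_l=x_{3/2}-\alpha h$, so only $I_1$ is cut, with $I_1\cap\Omega$ of length $\alpha h$. **Meaning of the unknowns.** $u_j^n$ is the constant value on $I_j\cap\Omega$ of the piecewise constant numerical solution $u_h(\cdot,t_n)$. The displayed scheme is the fully discrete form of the semi-discrete scheme $(u_{h,t},v_h)_\Omega+\gamma_M J_1(u_{h,t},v_h)+a(u_h,v_h)+\gamma_A J_0(u_h,v_h)=0$ for all piecewise constant $v_h$. Here $a$ is the upwind DG form with periodic boundary conditions, and $J_s(u,v)=h^{s}[u]_{x_{3/2}}[v]_{x_{3/2}}$ for $s=0,1$ is the ghost penalty stabilization (with weight $w_0=1$), where $[v]=v^+-v^-$ is the jump, i.e. right limit minus left limit. *)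

theory Defs
  imports Complex_Main
begin

text \<open>
  A piecewise constant function on the cut mesh is given by its cell values
  \<open>v j\<close>, \<open>j = 1, \<dots>, N\<close>: the value on the part of the \<open>j\<close>-th element inside the domain.
  Values at indices outside \<open>{1..N}\<close> are irrelevant.

  The step is a relation between the old values \<open>v\<close> and the new values \<open>w\<close>, because the ghost
  penalty in the mass term couples the new values on the cut element and its right neighbour.
  The first two equations are tested with the indicator functions of the elements 1 and 2;
  the factor \<open>h\<close> has been divided out and \<open>lam\<close> is the ratio of time step and mesh size.
\<close>

definition cut_dg_euler_step ::
  "nat \<Rightarrow> real \<Rightarrow> real \<Rightarrow> real \<Rightarrow> real \<Rightarrow> (nat \<Rightarrow> real) \<Rightarrow> (nat \<Rightarrow> real) \<Rightarrow> bool"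
  where
  "cut_dg_euler_step N \<alpha> \<gamma>M \<gamma>A lam v w \<longleftrightarrow>
     \<alpha> * w 1 + \<gamma>M * w 1 - \<gamma>M * w 2
       = \<alpha> * v 1 - \<gamma>M * v 2 + \<gamma>M * v 1 + lam * (v N - v 1) + lam * \<gamma>A * (v 2 - v 1) \<and>
     w 2 + \<gamma>M * w 2 - \<gamma>M * w 1
       = v 2 - \<gamma>M * v 1 + \<gamma>M * v 2 + lam * (v 1 - v 2) - lam * \<gamma>A * (v 2 - v 1) \<and>
     (\<forall>j\<in>{3..N}. w j = v j + lam * (v (j - 1) - v j))"

text \<open>The update at index 0 is the periodic convention for the left neighbour of element 1.\<close>

definition total_variation :: "nat \<Rightarrow> (nat \<Rightarrow> real) \<Rightarrow> real" where
  "total_variation N v = (\<Sum>j = 1..N. \<bar>v j - (v(0 := v N)) (j - 1)\<bar>)"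

end

theory Submission imports Defs begin

text \<open>
  After solving the coupled \<open>2 \<times> 2\<close> system for the cells 1 and 2, whose determinant is
  \<open>D = \<alpha> + \<alpha> \<gamma>M + \<gamma>M\<close>, the new periodic increments are linear combinations of the old
  ones. In the resulting coefficient matrix every column sums to 1, and the hypotheses
  make all entries nonnegative (the time step restriction also gives
  \<open>\<Delta>t / h \<le> 1\<close>, because the parameter conditions force \<open>\<alpha> \<gamma>M \<le> 1 - \<alpha>\<close>). Such a matrix
  does not increase the \<open>\<ell>\<^sup>1\<close>-norm.
\<close>

text \<open>The first three increments meet the coupled cells 1 and 2 and need separate estimates;
  from index 4 on, both cells of an increment follow the plain upwind update.\<close>

lemma total_variation_split:
  assumes "N \<ge> 3"
  shows "total_variation N v =
    \<bar>v 1 - v N\<bar> + \<bar>v 2 - v 1\<bar> + \<bar>v 3 - v 2\<bar> + (\<Sum>j = 4..N. \<bar>v j - v (j - 1)\<bar>)"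
proof -
  have "{1..N} = {1, 2, 3} \<union> {4..N}"
    using assms by auto
  moreover have "(\<Sum>j = 4..N. \<bar>v j - (v(0 := v N)) (j - 1)\<bar>) = (\<Sum>j = 4..N. \<bar>v j - v (j - 1)\<bar>)"
    by (intro sum.cong) auto
  ultimately show ?thesis
    unfolding total_variation_def by (simp add: sum.union_disjoint)
qed

text \<open>Both sides are the sum of \<open>f\<close> over \<open>{k..n}\<close>. Used with
  \<open>k = 3\<close> to reindex the upwind neighbours' increments.\<close>

lemma sum_pred_shift:
  fixes f :: "nat \<Rightarrow> real"
  assumes "k \<le> n"
  shows "(\<Sum>j = Suc k..n. f (j - 1)) + f n = f k + (\<Sum>j = Suc k..n. f j)"
  using assms by (induction n rule: dec_induct) (simp_all add: algebra_simps)

lemma abs_lincomb_le: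
  fixes p q x y :: real
  assumes "0 \<le> p" "0 \<le> q"
  shows "\<bar>p * x + q * y\<bar> \<le> p * \<bar>x\<bar> + q * \<bar>y\<bar>"
  using abs_triangle_ineq[of "p * x" "q * y"] assms by (simp add: abs_mult)

lemma abs_lincomb3_le:
  fixes p q r x y z :: real
  assumes "0 \<le> p" "0 \<le> q" "0 \<le> r"
  shows "\<bar>p * x + q * y + r * z\<bar> \<le> p * \<bar>x\<bar> + q * \<bar>y\<bar> + r * \<bar>z\<bar>"
  using abs_triangle_ineq[of "p * x + q * y" "r * z"] abs_lincomb_le[of p q x y] assms
  by (simp add: abs_mult)

text \<open>Cramer's rule with the determinant (\<alpha> + \<gamma>)(1 + \<gamma>) - \<gamma>^2 kept
  on the left, so that no division occurs.\<close>

lemma cramer_cut_cells: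
  fixes \<alpha> \<gamma> x y r s :: real
  assumes "(\<alpha> + \<gamma>) * x - \<gamma> * y = r" and "(1 + \<gamma>) * y - \<gamma> * x = s"
  shows "(\<alpha> + \<alpha> * \<gamma> + \<gamma>) * x = (1 + \<gamma>) * r + \<gamma> * s"
    and "(\<alpha> + \<alpha> * \<gamma> + \<gamma>) * y = \<gamma> * r + (\<alpha> + \<gamma>) * s"
  unfolding assms[symmetric] by (simp_all add: algebra_simps)

lemma cut_dg_euler_step_tvd:
  assumes "N \<ge> 3" and "0 < \<alpha>" and "0 \<le> lam"
    and step: "cut_dg_euler_step N \<alpha> \<gamma>M \<gamma>A lam v w"
    and cfl: "lam \<le> \<alpha> + \<gamma>M / (\<gamma>M + 1)"
    and "0 \<le> \<gamma>M" and "\<gamma>M \<le> \<gamma>A" and params: "(1 + \<alpha>) * \<gamma>A - \<gamma>M \<le> 1 - \<alpha>"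
  shows "total_variation N w \<le> total_variation N v"
proof -
  define D where "D = \<alpha> + \<alpha> * \<gamma>M + \<gamma>M"
  define l where "l = lam / D"
  define d1 d2 d3 dN where "d1 = v 1 - v N" and "d2 = v 2 - v 1" and "d3 = v 3 - v 2"
    and "dN = v N - v (N - 1)"
  have "0 < D"
    using \<open>0 < \<alpha>\<close> \<open>0 \<le> \<gamma>M\<close> unfolding D_def by (simp add: add_pos_nonneg)
  then have lam: "lam = l * D" and "0 \<le> l"
    using \<open>0 \<le> lam\<close> by (simp_all add: l_def)
  \<comment> \<open>In terms of \<open>l\<close>, the time step restriction becomes
    \<open>l * (1 + \<gamma>M) \<le> 1\<close>, which is nonnegativity of the weight of
    \<open>d1\<close> in \<open>w 1 - w N\<close>.\<close>
  have "\<alpha> + \<gamma>M / (\<gamma>M + 1) = D / (1 + \<gamma>M)"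
    using \<open>0 \<le> \<gamma>M\<close> by (simp add: D_def field_simps)
  then have "lam * (1 + \<gamma>M) \<le> D"
    using cfl \<open>0 \<le> \<gamma>M\<close> by (simp add: pos_le_divide_eq)
  then have l_le: "l * (1 + \<gamma>M) \<le> 1"
    using \<open>0 < D\<close> by (simp add: l_def)
  have "(1 + \<alpha>) * \<gamma>M \<le> (1 + \<alpha>) * \<gamma>A"
    using \<open>\<gamma>M \<le> \<gamma>A\<close> \<open>0 < \<alpha>\<close> by simp
  then have "D \<le> 1 + \<gamma>M"
    using params by (simp add: D_def algebra_simps)
  then have "lam \<le> 1"
    using mult_left_mono[OF _ \<open>0 \<le> l\<close>, of D "1 + \<gamma>M"] l_le lam by simp
  \<comment> \<open>\<open>params\<close> says that the bracket is at most
    \<open>1 + \<gamma>M\<close>; this gives the sign of the weight of \<open>d2\<close> in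
    \<open>w 2 - w 1\<close>.\<close>
  have "l * (\<alpha> + (1 + \<alpha>) * \<gamma>A) \<le> 1"
    using mult_left_mono[OF _ \<open>0 \<le> l\<close>, of "\<alpha> + (1 + \<alpha>) * \<gamma>A" "1 + \<gamma>M"] l_le params by simp
  note coeffs = \<open>0 \<le> l\<close> \<open>0 < \<alpha>\<close> \<open>0 \<le> \<gamma>M\<close> \<open>\<gamma>M \<le> \<gamma>A\<close> l_le \<open>0 \<le> lam\<close> \<open>lam \<le> 1\<close> this

  \<comment> \<open>The stabilized mass matrix acts on old and new values alike, so the system is
    solved for the updates \<open>w - v\<close>, with only increments on the right.\<close>
  have "(\<alpha> + \<gamma>M) * (w 1 - v 1) - \<gamma>M * (w 2 - v 2) = lam * (\<gamma>A * d2 - d1)"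
    and "(1 + \<gamma>M) * (w 2 - v 2) - \<gamma>M * (w 1 - v 1) = - lam * (1 + \<gamma>A) * d2"
    using step unfolding cut_dg_euler_step_def d1_def d2_def by (simp_all add: algebra_simps)
  note cramer = cramer_cut_cells[OF this, folded D_def]
  have "D * (w 1 - v 1) = D * (l * ((\<gamma>A - \<gamma>M) * d2 - (1 + \<gamma>M) * d1))"
    unfolding cramer lam by (simp add: algebra_simps)
  then have w1: "w 1 = v 1 + l * ((\<gamma>A - \<gamma>M) * d2 - (1 + \<gamma>M) * d1)"
    using \<open>0 < D\<close> by simp
  have "D * (w 2 - v 2) = D * (- l * (\<gamma>M * d1 + (\<alpha> + \<gamma>M + \<alpha> * \<gamma>A) * d2))"
    unfolding cramer lam by (simp add: algebra_simps)
  then have "w 2 - v 2 = - l * (\<gamma>M * d1 + (\<alpha> + \<gamma>M + \<alpha> * \<gamma>A) * d2)"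
    using \<open>0 < D\<close> by (subst (asm) mult_left_cancel) auto
  then have w2: "w 2 = v 2 - l * (\<gamma>M * d1 + (\<alpha> + \<gamma>M + \<alpha> * \<gamma>A) * d2)"
    by simp
  have wj: "w j = v j + lam * (v (j - 1) - v j)" if "j \<in> {3..N}" for j
    using step that unfolding cut_dg_euler_step_def by blast
  have w3: "w 3 = v 3 - lam * d3"
    using wj[of 3] \<open>N \<ge> 3\<close> by (simp add: d3_def algebra_simps)
  have wN: "w N = v N - lam * dN"
    using wj[of N] \<open>N \<ge> 3\<close> by (simp add: dN_def algebra_simps)

  \<comment> \<open>The weight of \<open>d2\<close> is nonnegative by
    \<open>\<gamma>M \<le> \<gamma>A\<close>; \<open>dN\<close> enters through the periodic
    wraparound.\<close>
  have "w 1 - w N = (1 - l * (1 + \<gamma>M)) * d1 + (l * (\<gamma>A - \<gamma>M)) * d2 + lam * dN"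
    unfolding w1 wN by (simp add: d1_def algebra_simps)
  then have e1: "\<bar>w 1 - w N\<bar> \<le>
      (1 - l * (1 + \<gamma>M)) * \<bar>d1\<bar> + (l * (\<gamma>A - \<gamma>M)) * \<bar>d2\<bar> + lam * \<bar>dN\<bar>"
    using coeffs by (simp only:) (intro abs_lincomb3_le; simp)
  have "w 2 - w 1 = l * d1 + (1 - l * (\<alpha> + (1 + \<alpha>) * \<gamma>A)) * d2"
    unfolding w1 w2 by (simp add: d2_def algebra_simps)
  then have e2: "\<bar>w 2 - w 1\<bar> \<le> l * \<bar>d1\<bar> + (1 - l * (\<alpha> + (1 + \<alpha>) * \<gamma>A)) * \<bar>d2\<bar>"
    using coeffs by (simp only:) (intro abs_lincomb_le; simp)
  have "w 3 - w 2 = (l * \<gamma>M) * d1 + (l * (\<alpha> + \<gamma>M + \<alpha> * \<gamma>A)) * d2 + (1 - lam) * d3"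
    unfolding w2 w3 by (simp add: d3_def algebra_simps)
  then have e3: "\<bar>w 3 - w 2\<bar> \<le>
      (l * \<gamma>M) * \<bar>d1\<bar> + (l * (\<alpha> + \<gamma>M + \<alpha> * \<gamma>A)) * \<bar>d2\<bar> + (1 - lam) * \<bar>d3\<bar>"
    using coeffs by (simp only:) (intro abs_lincomb3_le; simp)
  have ej: "\<bar>w j - w (j - 1)\<bar> \<le>
      (1 - lam) * \<bar>v j - v (j - 1)\<bar> + lam * \<bar>v (j - 1) - v (j - 1 - 1)\<bar>" if "j \<in> {4..N}" for j
  proof -
    from that have "j \<in> {3..N}" "j - 1 \<in> {3..N}"
      by auto
    from this[THEN wj]
    have "w j - w (j - 1) = (1 - lam) * (v j - v (j - 1)) + lam * (v (j - 1) - v (j - 1 - 1))"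
      by (simp add: algebra_simps)
    then show ?thesis
      using coeffs by (simp only:) (intro abs_lincomb_le; simp)
  qed

  let ?S = "\<Sum>j = 4..N. \<bar>v j - v (j - 1)\<bar>"
  have "(\<Sum>j = 4..N. \<bar>w j - w (j - 1)\<bar>) \<le>
      (1 - lam) * ?S + lam * (\<Sum>j = 4..N. \<bar>v (j - 1) - v (j - 1 - 1)\<bar>)"
    unfolding sum_distrib_left sum.distrib[symmetric] by (intro sum_mono ej)
  \<comment> \<open>The shift gains the increment at 3 and loses the one at \<open>N\<close>. For
    \<open>N = 3\<close> the sums are empty and \<open>d3 = dN\<close>.\<close>
  moreover have "(\<Sum>j = 4..N. \<bar>v (j - 1) - v (j - 1 - 1)\<bar>) = \<bar>d3\<bar> + ?S - \<bar>dN\<bar>"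
    using sum_pred_shift[of 3 N "\<lambda>j. \<bar>v j - v (j - 1)\<bar>"] \<open>N \<ge> 3\<close> by (simp add: d3_def dN_def)
  ultimately have "(\<Sum>j = 4..N. \<bar>w j - w (j - 1)\<bar>) \<le> (1 - lam) * ?S + lam * (\<bar>d3\<bar> + ?S - \<bar>dN\<bar>)"
    by simp
  \<comment> \<open>Column sums: the weights of \<open>d1\<close> and of \<open>d2\<close> in
    \<open>e1\<close>, \<open>e2\<close>, \<open>e3\<close> add up to 1, the \<open>lam\<close>
    missing from \<open>d3\<close> in \<open>e3\<close> comes from the shifted sum, and the
    \<open>dN\<close> term of \<open>e1\<close> cancels the one lost there.\<close>
  then have "total_variation N w \<le> \<bar>d1\<bar> + \<bar>d2\<bar> + \<bar>d3\<bar> + ?S"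
    using e1 e2 e3 unfolding total_variation_split[OF \<open>N \<ge> 3\<close>] by (simp add: algebra_simps)
  then show ?thesis
    unfolding total_variation_split[OF \<open>N \<ge> 3\<close>] by (simp add: d1_def d2_def d3_def)
qed

theorem theorem4p4:
  fixes N :: nat and \<alpha> h \<Delta>t \<gamma>M \<gamma>A :: real
    and u :: "nat \<Rightarrow> nat \<Rightarrow> real"
  assumes "N \<ge> 3"
    and "0 < \<alpha>" and "\<alpha> \<le> 1"
    and "h > 0" and "\<Delta>t > 0"
    and scheme: "\<And>n. cut_dg_euler_step N \<alpha> \<gamma>M \<gamma>A (\<Delta>t / h) (u n) (u (Suc n))"
    and "\<Delta>t / h \<le> \<alpha> + \<gamma>M / (\<gamma>M + 1)"
    and "0 < \<gamma>M" and "\<gamma>M \<le> \<gamma>A"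
    and "(1 + \<alpha>) * \<gamma>A - \<gamma>M \<le> 1 - \<alpha>"
  shows "\<forall>n. total_variation N (u (Suc n)) \<le> total_variation N (u n)"
  using assms by (intro allI cut_dg_euler_step_tvd[OF _ _ _ scheme]) simp_all

end
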